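(* Let $M$ be a manifold without boundary with $d=\dim M\ge 3$, let $u$ be an integer with $1\le u<d$, and let $f:M\to M$ be a diffeomorphism. Let $\Gamma$ be a non-empty family of discs of dimension $u$ in $M$ that can be expressed as finite unions $$\Gamma=\bigcup_{i\in I}\mathcal{U}_i=\bigcup_{j\in J}\mathcal{V}_j,$$ where the $\mathcal{U}_i$ are small u-tubes and the $\mathcal{V}_j$ are big u-tubes. Suppose that for all $i\in I$ there exists $j\in J$ such that $\mathcal{U}_i$ maps through $\mathcal{V}_j$. Then $\Gamma$ is a blender, that is, a cu-blender of index $u$ for $f$.
   Context: A disc (of dimension $u$) is the image in $M$ of an element of $C^1(\mathbb{D}^u,M)$, where $\mathbb{D}^u$ is the closed unit disc in $\mathbb{R}^u$. In this general setting, a u-tube is a subfamily of the family of discs, i.e. a set of $u$-dimensional discs; the words "small" and "big" are labels distinguishing the two finite collections $\{\mathcal{U}_i\}_{i\in I}$ and $\{\mathcal{V}_j\}_{j\in J}$. A small u-tube $\mathcal{U}$ maps through a big u-tube $\mathcal{V}$ (under $f$) if there exists a $C^1$-open neighbourhood $\mathcal{F}$ of $f$ such that for every $\gamma\in\mathcal{U}$ there exists $\sigma\subset\gamma$ such that $g(\sigma)\in\mathcal{V}$ for every $g\in\mathcal{F}$ (so a single $\sigma$ serves for all $g\in\mathcal{F}$). A cu-blender of index $u$ for $f$ is a family $\Gamma$ of discs of dimension $u$ with the following property: there is a $C^1$-open neighbourhood $\mathcal{F}$ of $f$ such that for every $g\in\mathcal{F}$ and every $\gamma\in\Gamma$ there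 is a subset $\sigma\subset\gamma$ such that $g(\sigma)\in\Gamma$. *)

theory Defs
  imports "HOL-Analysis.Analysis"
begin

text \<open>
  For open \<open>S\<close> the derivative below is the usual one. For a relatively open subset of a closed
  ball, \<open>at x within S\<close> still determines the derivative, and the notion agrees with having
  local \<open>C\<^sup>1\<close> extensions to open sets.
\<close>

definition C1_on :: "('a::euclidean_space \<Rightarrow> 'b::euclidean_space) \<Rightarrow> 'a set \<Rightarrow> bool" where
  "C1_on h S \<longleftrightarrow>
     (\<exists>h' :: 'a \<Rightarrow> 'a \<Rightarrow>\<^sub>L 'b.
        (\<forall>x\<in>S. (h has_derivative blinfun_apply (h' x)) (at x within S)) \<and> continuous_on S h')"

text \<open>
  The manifold \<open>M\<close> is the whole (Hausdorff, second countable) type \<open>'m\<close>; its differentiable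
  structure is given by an atlas, a set of pairs of a domain \<open>U\<close> and a coordinate
  map \<open>\<phi>\<close>, whose values outside \<open>U\<close> are irrelevant. Every smooth atlas is
  in particular a \<open>C\<^sup>1\<close> atlas. Charts take values in open subsets of the full
  Euclidean space, so there is no boundary.
\<close>

type_synonym ('m, 'd) chart = "'m set \<times> ('m \<Rightarrow> real ^ 'd)"

definition is_chart :: "('m::topological_space, 'd::finite) chart \<Rightarrow> bool" where
  "is_chart = (\<lambda>(U, \<phi>). open U \<and> open (\<phi> ` U) \<and> homeomorphism U (\<phi> ` U) \<phi> (inv_into U \<phi>))"

definition C1_atlas ::
    "('m::{t2_space, second_countable_topology}, 'd::finite) chart set \<Rightarrow> bool" where
  "C1_atlas \<A> \<longleftrightarrow>
     (\<forall>c\<in>\<A>. is_chart c) \<and>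
     (\<Union>(U, \<phi>)\<in>\<A>. U) = UNIV \<and>
     (\<forall>(U, \<phi>)\<in>\<A>. \<forall>(V, \<psi>)\<in>\<A>. C1_on (\<psi> \<circ> inv_into U \<phi>) (\<phi> ` (U \<inter> V)))"

definition C1_map ::
    "('m::{t2_space, second_countable_topology}, 'd::finite) chart set \<Rightarrow> ('m \<Rightarrow> 'm) \<Rightarrow> bool" where
  "C1_map \<A> f \<longleftrightarrow>
     continuous_on UNIV f \<and>
     (\<forall>(U, \<phi>)\<in>\<A>. \<forall>(V, \<psi>)\<in>\<A>.
        C1_on (\<psi> \<circ> f \<circ> inv_into U \<phi>) (\<phi> ` (U \<inter> f -` V)))"

definition Diff1 ::
    "('m::{t2_space, second_countable_topology}, 'd::finite) chart set \<Rightarrow> ('m \<Rightarrow> 'm) set" where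
  "Diff1 \<A> = {f. bij f \<and> C1_map \<A> f \<and> C1_map \<A> (inv f)}"

text \<open>
  The \<open>C\<^sup>1\<close> topology on the group of diffeomorphisms is the weak (compact-open) one,
  i.e. uniform convergence of values and first derivatives, in charts, on compact sets. It is
  generated by the following sets and does not depend on the choice of atlas within a
  \<open>C\<^sup>1\<close> structure. For compact \<open>M\<close> it coincides with the strong (Whitney) topology.
\<close>

definition C1_nbhd ::
    "('m::{t2_space, second_countable_topology}, 'd::finite) chart set \<Rightarrow> ('m \<Rightarrow> 'm) \<Rightarrow>
     ('m, 'd) chart \<Rightarrow> ('m, 'd) chart \<Rightarrow> 'm set \<Rightarrow> real \<Rightarrow> ('m \<Rightarrow> 'm) set" where
  "C1_nbhd \<A> f = (\<lambda>(U, \<phi>) (V, \<psi>) K \<epsilon>.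
     {g \<in> Diff1 \<A>. g ` K \<subseteq> V \<and>
        (\<forall>x \<in> \<phi> ` K.
           norm ((\<psi> \<circ> f \<circ> inv_into U \<phi>) x - (\<psi> \<circ> g \<circ> inv_into U \<phi>) x) < \<epsilon> \<and>
           onorm (\<lambda>v. frechet_derivative (\<psi> \<circ> f \<circ> inv_into U \<phi>) (at x) v
                      - frechet_derivative (\<psi> \<circ> g \<circ> inv_into U \<phi>) (at x) v) < \<epsilon>)})"

definition C1_topology ::
    "('m::{t2_space, second_countable_topology}, 'd::finite) chart set \<Rightarrow> ('m \<Rightarrow> 'm) topology" where
  "C1_topology \<A> = topology_generated_by
     {C1_nbhd \<A> f (U, \<phi>) (V, \<psi>) K \<epsilon> | f U \<phi> V \<psi> K \<epsilon>.
        f \<in> Diff1 \<A> \<and> (U, \<phi>) \<in> \<A> \<and> (V, \<psi>) \<in> \<A> \<and>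
        compact K \<and> K \<subseteq> U \<and> f ` K \<subseteq> V \<and> 0 < \<epsilon>}"

definition C1_open_nbhd ::
    "('m::{t2_space, second_countable_topology}, 'd::finite) chart set \<Rightarrow> ('m \<Rightarrow> 'm) \<Rightarrow>
     ('m \<Rightarrow> 'm) set \<Rightarrow> bool" where
  "C1_open_nbhd \<A> f \<F> \<longleftrightarrow> openin (C1_topology \<A>) \<F> \<and> f \<in> \<F>"

text \<open>
  The dimension \<open>u\<close> of a disc is \<open>CARD('u)\<close>, passed as the type argument \<open>TYPE('u)\<close>.
\<close>

definition C1_disc_map ::
    "('m::{t2_space, second_countable_topology}, 'd::finite) chart set \<Rightarrow>
     (real ^ 'u::finite \<Rightarrow> 'm) \<Rightarrow> bool" where
  "C1_disc_map \<A> h \<longleftrightarrow>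
     continuous_on (cball 0 1) h \<and>
     (\<forall>(U, \<phi>)\<in>\<A>. C1_on (\<phi> \<circ> h) (cball 0 1 \<inter> h -` U))"

definition discs ::
    "('m::{t2_space, second_countable_topology}, 'd::finite) chart set \<Rightarrow> 'u::finite itself \<Rightarrow>
     'm set set" where
  "discs \<A> _ = {h ` cball 0 1 | h :: real ^ 'u \<Rightarrow> 'm. C1_disc_map \<A> h}"

definition u_tube ::
    "('m::{t2_space, second_countable_topology}, 'd::finite) chart set \<Rightarrow> 'u::finite itself \<Rightarrow>
     'm set set \<Rightarrow> bool" where
  "u_tube \<A> u \<U> \<longleftrightarrow> \<U> \<subseteq> discs \<A> u"

definition maps_through ::
    "('m::{t2_space, second_countable_topology}, 'd::finite) chart set \<Rightarrow> ('m \<Rightarrow> 'm) \<Rightarrow>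
     'm set set \<Rightarrow> 'm set set \<Rightarrow> bool" where
  "maps_through \<A> f \<U> \<V> \<longleftrightarrow>
     (\<exists>\<F>. C1_open_nbhd \<A> f \<F> \<and> (\<forall>\<gamma>\<in>\<U>. \<exists>\<sigma>. \<sigma> \<subseteq> \<gamma> \<and> (\<forall>g\<in>\<F>. g ` \<sigma> \<in> \<V>)))"

definition cu_blender ::
    "('m::{t2_space, second_countable_topology}, 'd::finite) chart set \<Rightarrow> 'u::finite itself \<Rightarrow>
     ('m \<Rightarrow> 'm) \<Rightarrow> 'm set set \<Rightarrow> bool" where
  "cu_blender \<A> u f \<Gamma> \<longleftrightarrow>
     \<Gamma> \<subseteq> discs \<A> u \<and>
     (\<exists>\<F>. C1_open_nbhd \<A> f \<F> \<and> (\<forall>g\<in>\<F>. \<forall>\<gamma>\<in>\<Gamma>. \<exists>\<sigma>. \<sigma> \<subseteq> \<gamma> \<and> g ` \<sigma> \<in> \<Gamma>))"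

end

theory Submission
  imports Defs
begin

text \<open>Each small tube comes with its own neighbourhood of \<open>f\<close>, on which its discs
  have sub-pieces sent into a big tube, hence into \<Gamma>. As there are finitely many small tubes,
  the intersection of these neighbourhoods is still open and contains \<open>f\<close>. Covering
  \<Gamma> by small tubes makes it work for every disc; covering by big tubes brings the images back
  into \<Gamma>.\<close>

text \<open>Nonemptiness of \<open>I\<close> matters: the empty intersection is \<open>UNIV\<close>,
  whereas every open set of \<open>C1_topology\<close> consists of diffeomorphisms.\<close>

lemma C1_open_nbhd_INT:
  assumes "finite I" and "I \<noteq> {}" and "\<And>i. i \<in> I \<Longrightarrow> C1_open_nbhd \<A> f (F i)"
  shows "C1_open_nbhd \<A> f (\<Inter>i\<in>I. F i)"
  using assms by (auto simp: C1_open_nbhd_def intro!: openin_Inter)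

theorem theorem1p1:
  fixes \<A> :: "('m::{t2_space, second_countable_topology}, 'd::finite) chart set"
    and f :: "'m \<Rightarrow> 'm"
    and \<Gamma> :: "'m set set"
    and I :: "'i set" and J :: "'j set"
    and \<U> :: "'i \<Rightarrow> 'm set set" and \<V> :: "'j \<Rightarrow> 'm set set"
  assumes "C1_atlas \<A>"
    and "3 \<le> CARD('d)"
    and "1 \<le> CARD('u::finite)" and "CARD('u) < CARD('d)"
    and "f \<in> Diff1 \<A>"
    and "\<Gamma> \<noteq> {}" and "\<Gamma> \<subseteq> discs \<A> TYPE('u)"
    and "finite I" and "finite J"
    and "\<And>i. i \<in> I \<Longrightarrow> u_tube \<A> TYPE('u) (\<U> i)"
    and "\<And>j. j \<in> J \<Longrightarrow> u_tube \<A> TYPE('u) (\<V> j)"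
    and "\<Gamma> = (\<Union>i\<in>I. \<U> i)" and "\<Gamma> = (\<Union>j\<in>J. \<V> j)"
    and "\<And>i. i \<in> I \<Longrightarrow> \<exists>j\<in>J. maps_through \<A> f (\<U> i) (\<V> j)"
  shows "cu_blender \<A> TYPE('u) f \<Gamma>"
proof -
  \<comment> \<open>Enlarging the target from \<open>\<V> j\<close> to \<Gamma> removes
    \<open>j\<close>, so only the neighbourhood has to be chosen as a function of
    \<open>i\<close>.\<close>
  have "\<exists>F. C1_open_nbhd \<A> f F \<and> (\<forall>\<gamma>\<in>\<U> i. \<exists>\<sigma>. \<sigma> \<subseteq> \<gamma> \<and> (\<forall>g\<in>F. g ` \<sigma> \<in> \<Gamma>))" if "i \<in> I" for i
  proof -
    from assms(14)[OF that] obtain j where "j \<in> J" and "maps_through \<A> f (\<U> i) (\<V> j)"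
      by blast
    moreover have "\<V> j \<subseteq> \<Gamma>"
      using \<open>j \<in> J\<close> unfolding assms(13) by blast
    ultimately show ?thesis
      unfolding maps_through_def by (meson subsetD)
  qed
  then obtain F where F: "\<And>i. i \<in> I \<Longrightarrow> C1_open_nbhd \<A> f (F i)"
    and sub: "\<And>i \<gamma>. i \<in> I \<Longrightarrow> \<gamma> \<in> \<U> i \<Longrightarrow> \<exists>\<sigma>. \<sigma> \<subseteq> \<gamma> \<and> (\<forall>g\<in>F i. g ` \<sigma> \<in> \<Gamma>)"
    by metis
  have "I \<noteq> {}"
    using assms(6,12) by auto
  then have "C1_open_nbhd \<A> f (\<Inter>i\<in>I. F i)"
    using assms(8) F by (intro C1_open_nbhd_INT)
  moreover have "\<exists>\<sigma>. \<sigma> \<subseteq> \<gamma> \<and> g ` \<sigma> \<in> \<Gamma>" if "g \<in> (\<Inter>i\<in>I. F i)" and "\<gamma> \<in> \<Gamma>" for g \<gamma>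
  proof -
    from \<open>\<gamma> \<in> \<Gamma>\<close> obtain i where "i \<in> I" and "\<gamma> \<in> \<U> i"
      unfolding assms(12) by blast
    \<comment> \<open>The piece \<sigma> found for \<gamma> serves all of \<open>F i\<close>, in
      particular the given \<open>g\<close>.\<close>
    then show ?thesis
      using sub that(1) by blast
  qed
  ultimately show ?thesis
    unfolding cu_blender_def using assms(7) by blast
qed

end
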